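(* $$\frac{\sin(6\pi/13)\sin(2\pi/13)\sin(5\pi/13)}{\sin(4\pi/13)\sin(3\pi/13)\sin(\pi/13)}-\frac{\sin(4\pi/13)\sin(3\pi/13)\sin(\pi/13)}{\sin(6\pi/13)\sin(2\pi/13)\sin(5\pi/13)}=3.$$ *)

theory Defs
  imports Complex_Main
begin

end

theory Submission
  imports Defs
begin

text \<open>
  The fourth powers \<open>{1, 3, 9}\<close> form the subgroup of order 3 of the units modulo 13. Let \<open>S x\<close>
  and \<open>C x\<close> be the sums of \<open>sin (k x)\<close> and \<open>cos (k x)\<close> over it: when \<open>x\<close> is a multiple of
  \<open>2 \<pi> / 13\<close>, these are the imaginary and real parts of a Gaussian period. Assume only
  \<open>sin (13 x) = 0\<close> and let \<open>\<epsilon> = cos (13 x) = \<plusminus> 1\<close>. Since \<open>4 = 13 - 9\<close>, multiplication by 4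
  maps \<open>{1, 3, 9}\<close> to its negative modulo 13, so \<open>C (4 x) = \<epsilon> C x\<close>. The triple products \<open>A\<close>
  (multipliers 6, 2, 5) and \<open>B\<close> (multipliers 4, 3, 1) linearise to \<open>4 A = S x\<close> and
  \<open>4 B = S (2 x)\<close>. Linearising once more, both \<open>(S x)\<^sup>2 - (S (2 x))\<^sup>2\<close> and \<open>S x S (2 x)\<close> are
  multiples of \<open>C x - \<epsilon> C (2 x)\<close>, whence \<open>A\<^sup>2 - B\<^sup>2 = - 3 \<epsilon> A B\<close>; at \<open>x = \<pi> / 13\<close> the
  sign \<open>\<epsilon>\<close> is \<open>- 1\<close>.
\<close>

lemma sin_times_sin_times_sin:
  fixes a b c :: real
  shows "4 * (sin a * sin b * sin c) =
    sin (a + b - c) + sin (a - b + c) + sin (b + c - a) - sin (a + b + c)"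
proof -
  have linearise_ab: "sin a * sin b * sin c = (cos (a - b) * sin c - cos (a + b) * sin c) / 2"
    by (simp add: sin_times_sin algebra_simps)
  have "sin (a - b - c) = - sin (b + c - a)"
    by (simp flip: sin_minus add: algebra_simps)
  then show ?thesis
    unfolding linearise_ab cos_times_sin by (simp add: field_simps)
qed

lemma sin_sum3_squared:
  fixes a b c :: real
  shows "(sin a + sin b + sin c)\<^sup>2 =
    3 / 2 - (cos (2 * a) + cos (2 * b) + cos (2 * c)) / 2
      + (cos (a - b) - cos (a + b)) + (cos (a - c) - cos (a + c)) + (cos (b - c) - cos (b + c))"
proof -
  have "(sin a + sin b + sin c)\<^sup>2 = (sin a)\<^sup>2 + (sin b)\<^sup>2 + (sin c)\<^sup>2
      + 2 * (sin a * sin b) + 2 * (sin a * sin c) + 2 * (sin b * sin c)"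
    by (simp add: power2_eq_square algebra_simps)
  then show ?thesis
    by (simp add: sin_times_sin cos_double_sin add_divide_distrib diff_divide_distrib)
qed

lemma cos_diff_of_sin_eq_0:
  fixes a b :: real
  assumes "sin a = 0"
  shows "cos (a - b) = cos a * cos b"
  using assms by (simp add: cos_diff)

lemma cos_double_add_of_sin_eq_0:
  fixes a b :: real
  assumes "sin a = 0"
  shows "cos (2 * a + b) = cos b"
  using assms by (simp add: cos_add sin_double cos_double_sin)

lemma cos_double_diff_of_sin_eq_0:
  fixes a b :: real
  assumes "sin a = 0"
  shows "cos (2 * a - b) = cos b"
  using cos_double_add_of_sin_eq_0[OF assms, of "- b"] by simp

lemma sin_double_diff_of_sin_eq_0:
  fixes a b :: real
  assumes "sin a = 0"
  shows "sin (2 * a - b) = - sin b"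
  using assms by (simp add: sin_diff sin_double cos_double_sin)

definition sin_period13 :: "real \<Rightarrow> real"
  where "sin_period13 x = sin x + sin (3 * x) + sin (9 * x)"

definition cos_period13 :: "real \<Rightarrow> real"
  where "cos_period13 x = cos x + cos (3 * x) + cos (9 * x)"

lemma cos_period13_quadruple:
  assumes "sin (13 * x) = 0"
  shows "cos_period13 (4 * x) = cos (13 * x) * cos_period13 x"
proof -
  note cos_reflect = cos_diff_of_sin_eq_0[OF assms]
  have "cos (4 * x) = cos (13 * x) * cos (9 * x)" "cos (12 * x) = cos (13 * x) * cos x"
    using cos_reflect[of "9 * x"] cos_reflect[of x] by simp_all
  moreover have "cos (36 * x) = cos (13 * x) * cos (3 * x)"
    using cos_double_add_of_sin_eq_0[OF assms, of "10 * x"] cos_reflect[of "3 * x"] by simp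
  ultimately show ?thesis
    by (simp add: cos_period13_def algebra_simps)
qed

lemma sin_period13_squared:
  assumes "sin (13 * x) = 0"
  shows "(sin_period13 x)\<^sup>2 = 3 / 2 + cos_period13 (2 * x) / 2 - cos_period13 (4 * x)"
proof -
  have "cos (18 * x) = cos (8 * x)" "cos (36 * x) = cos (10 * x)"
    using cos_double_diff_of_sin_eq_0[OF assms, of "8 * x"]
      cos_double_add_of_sin_eq_0[OF assms, of "10 * x"] by simp_all
  moreover have "(sin_period13 x)\<^sup>2 =
      3 / 2 - (cos (2 * x) + cos (6 * x) + cos (18 * x)) / 2
        + (cos (2 * x) - cos (4 * x)) + (cos (8 * x) - cos (10 * x))
        + (cos (6 * x) - cos (12 * x))"
    using cos_minus[of "2 * x"] cos_minus[of "8 * x"] cos_minus[of "6 * x"]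
    by (simp add: sin_period13_def sin_sum3_squared)
  ultimately show ?thesis
    by (simp add: cos_period13_def field_simps)
qed

lemma sin_period13_times_double:
  assumes "sin (13 * x) = 0"
  shows "sin_period13 x * sin_period13 (2 * x) =
    (cos_period13 x - cos (13 * x) * cos_period13 (2 * x)) / 2"
proof -
  have "2 * (sin_period13 x * sin_period13 (2 * x)) =
      2 * cos x + cos (3 * x) + cos (17 * x)
        - cos (11 * x) - cos (19 * x) - cos (21 * x) - cos (27 * x)"
    by (simp add: sin_period13_def distrib_left distrib_right sin_times_sin
        add_divide_distrib diff_divide_distrib)
  moreover have "cos (17 * x) = cos (9 * x)" "cos (27 * x) = cos x"
    using cos_double_diff_of_sin_eq_0[OF assms, of "9 * x"]
      cos_double_add_of_sin_eq_0[OF assms, of x] by simp_all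
  moreover have "cos (11 * x) = cos (13 * x) * cos (2 * x)"
    using cos_diff_of_sin_eq_0[OF assms, of "2 * x"] by simp
  moreover have "cos (19 * x) = cos (13 * x) * cos (6 * x)"
    using cos_double_diff_of_sin_eq_0[OF assms, of "7 * x"]
      cos_diff_of_sin_eq_0[OF assms, of "6 * x"] by simp
  moreover have "cos (21 * x) = cos (13 * x) * cos (18 * x)"
    using cos_diff_of_sin_eq_0[OF assms, of "8 * x"]
      cos_double_diff_of_sin_eq_0[OF assms, of "5 * x"]
      cos_double_diff_of_sin_eq_0[OF assms, of "8 * x"] by simp
  ultimately show ?thesis
    by (simp add: cos_period13_def algebra_simps)
qed

lemma sin_period13_squared_diff:
  assumes "sin (13 * x) = 0"
  shows "(sin_period13 x)\<^sup>2 - (sin_period13 (2 * x))\<^sup>2 =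
    - 3 * cos (13 * x) * (sin_period13 x * sin_period13 (2 * x))"
proof -
  define \<epsilon> where "\<epsilon> = cos (13 * x)"
  have \<epsilon>_involution: "\<epsilon> * (\<epsilon> * y) = y" for y
    using cos_squared_eq[of "13 * x"] assms
    by (simp add: \<epsilon>_def power2_eq_square flip: mult.assoc)
  have sin_cos_26: "sin (13 * (2 * x)) = 0" "cos (13 * (2 * x)) = 1"
    using assms sin_double[of "13 * x"] cos_double_sin[of "13 * x"] by simp_all
  have cos_period_4: "cos_period13 (4 * x) = \<epsilon> * cos_period13 x"
    using cos_period13_quadruple[OF assms] by (simp add: \<epsilon>_def)
  have cos_period_8: "cos_period13 (8 * x) = cos_period13 (2 * x)"
    using cos_period13_quadruple[OF sin_cos_26(1)] sin_cos_26(2) by simp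
  have "(sin_period13 x)\<^sup>2 - (sin_period13 (2 * x))\<^sup>2 =
      3 / 2 * (cos_period13 (2 * x) - \<epsilon> * cos_period13 x)"
    using sin_period13_squared[OF assms] sin_period13_squared[OF sin_cos_26(1)]
    by (simp add: cos_period_4 cos_period_8)
  also have "\<dots> = - 3 * \<epsilon> * ((cos_period13 x - \<epsilon> * cos_period13 (2 * x)) / 2)"
    by (simp add: right_diff_distrib \<epsilon>_involution)
  also have "\<dots> = - 3 * \<epsilon> * (sin_period13 x * sin_period13 (2 * x))"
    using sin_period13_times_double[OF assms] by (simp add: \<epsilon>_def)
  finally show ?thesis
    by (simp add: \<epsilon>_def)
qed

lemma sin_6_times_sin_2_times_sin_5:
  assumes "sin (13 * x) = 0"
  shows "4 * (sin (6 * x) * sin (2 * x) * sin (5 * x)) = sin_period13 x"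
  unfolding sin_times_sin_times_sin sin_period13_def using assms by simp

lemma sin_4_times_sin_3_times_sin_1:
  assumes "sin (13 * x) = 0"
  shows "4 * (sin (4 * x) * sin (3 * x) * sin x) = sin_period13 (2 * x)"
proof -
  have "sin (18 * x) = - sin (8 * x)"
    using sin_double_diff_of_sin_eq_0[OF assms, of "8 * x"] by simp
  then show ?thesis
    unfolding sin_times_sin_times_sin sin_period13_def by simp
qed

lemma sin_triple_products_squared_diff:
  fixes x :: real
  defines "A \<equiv> sin (6 * x) * sin (2 * x) * sin (5 * x)"
    and "B \<equiv> sin (4 * x) * sin (3 * x) * sin x"
  assumes sin_13: "sin (13 * x) = 0"
  shows "A\<^sup>2 - B\<^sup>2 = - 3 * cos (13 * x) * (A * B)"
proof -
  have "sin_period13 x = 4 * A" "sin_period13 (2 * x) = 4 * B"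
    using sin_6_times_sin_2_times_sin_5[OF sin_13] sin_4_times_sin_3_times_sin_1[OF sin_13]
    by (simp_all add: A_def B_def)
  then show ?thesis
    using sin_period13_squared_diff[OF sin_13] by (simp add: power_mult_distrib)
qed

lemma divide_diff_divide_swap_eq_iff:
  fixes a b c :: "'a :: field"
  assumes "a \<noteq> 0" "b \<noteq> 0"
  shows "a / b - b / a = c \<longleftrightarrow> a\<^sup>2 - b\<^sup>2 = c * (a * b)"
  using assms by (simp add: diff_frac_eq divide_eq_eq power2_eq_square mult.commute)

theorem theorem4p7:
  shows "(sin (6 * pi / 13) * sin (2 * pi / 13) * sin (5 * pi / 13)) /
           (sin (4 * pi / 13) * sin (3 * pi / 13) * sin (pi / 13))
       - (sin (4 * pi / 13) * sin (3 * pi / 13) * sin (pi / 13)) /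
           (sin (6 * pi / 13) * sin (2 * pi / 13) * sin (5 * pi / 13)) = (3::real)"
    (is "?A / ?B - ?B / ?A = 3")
proof -
  have "?A \<noteq> 0" "?B \<noteq> 0"
    by (intro less_imp_neq[THEN not_sym] mult_pos_pos sin_gt_zero; simp)+
  moreover have "?A\<^sup>2 - ?B\<^sup>2 = 3 * (?A * ?B)"
    using sin_triple_products_squared_diff[of "pi / 13"] by simp
  ultimately show ?thesis
    by (rule divide_diff_divide_swap_eq_iff[THEN iffD2])
qed

end
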